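(* Let $T>0$, $A\in C([0,T];\mathbb{R}^{n\times n})$, $B\in C([0,T];\mathbb{R}^{n\times m})$, $E\in C([0,T];\mathbb{R}^{n\times\ell})$, and compact convex nonempty $\mathbb{U}\subset\mathbb{R}^m$, $\mathbb{D}\subset\mathbb{R}^\ell$. Assume that for every $t\in[0,T]$ the set $\mathbb{W}(t)=B(t)\mathbb{U}\ominus(-E(t)\mathbb{D})$ is nonempty. Let $L_g\ge0$, $\gamma_k\in\mathbb{R}$, $n_k\in\mathbb{N}$, points $\bar x_{i,k}\in\mathbb{R}^n$ and controls $\omega_{i,k}\in\mathscr{W}[0,T]$ ($1\le i\le n_k$) be given, let $\xi^\star_{i,k}$ be the solution on $[0,T]$ of $\dot\xi(s)=A(s)\xi(s)+\omega_{i,k}(s)$, $\xi(T)=\bar x_{i,k}$, and $\Omega^\star_k(t)=\mathrm{conv}(\{\xi^\star_{i,k}(t)\}_{i=1}^{n_k})$. Then $\bar v_k(t,x)=L_g\inf_{\xi\in\Omega^\star_k(t)}\|\Phi_A(T,t)(x-\xi)\|+\gamma_k$ is continuous on $[0,T]\times\mathbb{R}^n$.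
   Context: $\Phi_A(s,\tau)$ is the state-transition matrix of $\dot y(s)=A(s)y(s)$. For $Y,Z\subseteq\mathbb{R}^n$: $Y\ominus Z=\{c:\{c\}\oplus Z\subseteq Y\}$ where $\{c\}\oplus Z=\{c+z:z\in Z\}$, and $PY=\{Py:y\in Y\}$. $\mathscr{W}[0,T]$ is the set of measurable $\omega:[0,T]\to\mathbb{R}^n$ with $\omega(s)\in\mathbb{W}(s)$ for all $s$. *)

theory Defs
  imports "HOL-Analysis.Analysis"
begin

text \<open>Minkowski (Pontryagin) difference: Y \<ominus> Z = {c. {c} \<oplus> Z \<subseteq> Y}.\<close>
definition mink_diff :: "'a::ab_group_add set \<Rightarrow> 'a set \<Rightarrow> 'a set" where
  "mink_diff Y Z = {c. (\<lambda>z. c + z) ` Z \<subseteq> Y}"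

text \<open>Image of a set under a matrix: P Y = {P y | y \<in> Y}.\<close>
definition mat_image :: "real^'m^'n \<Rightarrow> (real^'m) set \<Rightarrow> (real^'n) set" where
  "mat_image P Y = (\<lambda>y. P *v y) ` Y"

text \<open>State-transition matrix Phi_A(s,tau) of y' = A(s) y on [0,T]:
  the value at s of the (unique) matrix solution X on [0,T] with X' = A X and X(tau) = I.\<close>
definition state_trans :: "real \<Rightarrow> (real \<Rightarrow> real^'n^'n) \<Rightarrow> real \<Rightarrow> real \<Rightarrow> real^'n^'n" where
  "state_trans T A s \<tau> = (THE M. \<exists>X. X \<tau> = mat 1 \<and>
      (\<forall>r\<in>{0..T}. (X has_vector_derivative (A r ** X r)) (at r within {0..T})) \<and> X s = M)"

text \<open>Admissible disturbance set W[0,T]: measurable selections of W(s) on [0,T].\<close>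
definition admissible :: "real \<Rightarrow> (real \<Rightarrow> (real^'n) set) \<Rightarrow> (real \<Rightarrow> real^'n) set" where
  "admissible T W = {\<omega>. \<omega> \<in> borel_measurable (lebesgue_on {0..T}) \<and> (\<forall>s\<in>{0..T}. \<omega> s \<in> W s)}"

text \<open>Value at t of the (Caratheodory) solution on [0,T] of xi' = A xi + omega, xi(T) = xbar,
  written in integral form: xi continuous and xi(T) - xi(t) = integral over [t,T] of (A xi + omega).\<close>
definition term_sol :: "real \<Rightarrow> (real \<Rightarrow> real^'n^'n) \<Rightarrow> (real \<Rightarrow> real^'n) \<Rightarrow> real^'n \<Rightarrow> real \<Rightarrow> real^'n" where
  "term_sol T A \<omega> xbar t = (THE y. \<exists>\<xi>. continuous_on {0..T} \<xi> \<and>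
      (\<forall>r\<in>{0..T}. ((\<lambda>s. A s *v \<xi> s + \<omega> s) has_integral (xbar - \<xi> r)) {r..T}) \<and> \<xi> t = y)"

end

theory Submission
  imports Defs
begin

(*
  Since Phi_A(T,t) is linear, v_k(t,x) is Lg times the distance from Phi_A(T,t) x to the convex
  hull of the finitely many points Phi_A(T,t) xi_i(t), plus gamma_k.  This distance is
  1-Lipschitz in the point and moves by at most sum_i |p_i - q_i| when the vertices move from
  q_i to p_i, so it suffices that t |-> Phi_A(T,t) and every trajectory xi_i are continuous.
  Both solve linear terminal value problems on [0,T], which are solved by Picard iteration: the
  bound M (K (T - t))^k / k! on the k-th iterate difference gives existence and, as in
  Gronwall's argument, uniqueness.  Phi_A(T,t) is the value at t of the solution of the adjoint
  equation W' = - W A, W(T) = I, and the disturbances are integrable because the set W(t) lies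
  in B(t) U + E(t) d for any fixed d in D, which is bounded uniformly in t.
*)

lemma has_integral_power_factorial:
  fixes K M r b :: real
  assumes "r \<le> b"
  shows "((\<lambda>s. K * (M * (K * (b - s)) ^ k / fact k)) has_integral
          M * (K * (b - r)) ^ Suc k / fact (Suc k)) {r..b}"
proof -
  let ?F = "\<lambda>s. - M * (K * (b - s)) ^ Suc k / fact (Suc k)"
  have "((\<lambda>s. K * (M * (K * (b - s)) ^ k / fact k)) has_integral ?F b - ?F r) {r..b}"
  proof (rule fundamental_theorem_of_calculus[OF assms])
    fix x assume "x \<in> {r..b}"
    have "(?F has_real_derivative
        (- M * (real (Suc k) * (K * (b - x)) ^ k * (K * (0 - 1))) / fact (Suc k)))
        (at x within {r..b})"
      by (intro derivative_eq_intros) auto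
    moreover have "- M * (real (Suc k) * (K * (b - x)) ^ k * (K * (0 - 1))) / fact (Suc k)
       = K * (M * (K * (b - x)) ^ k / fact k)"
      by (simp add: field_simps del: of_nat_Suc)
    ultimately show "(?F has_vector_derivative K * (M * (K * (b - x)) ^ k / fact k))
        (at x within {r..b})"
      by (metis has_real_derivative_iff_has_vector_derivative)
  qed
  then show ?thesis by simp
qed

lemma summable_exp_terms: "summable (\<lambda>k. M * x ^ k / fact k :: real)"
  using summable_mult[OF summable_exp[of x], of M] by (simp add: field_simps)

locale linear_terminal_problem =
  fixes P :: "'b::real_normed_vector \<Rightarrow> 'a::banach \<Rightarrow> 'a"
    and A :: "real \<Rightarrow> 'b" and a b :: real
  assumes bounded_bilinear: "bounded_bilinear P"
    and continuous_A: "continuous_on {a..b} A"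
    and a_le_b: "a \<le> b"
begin

text \<open>Integral form of \<open>y' = P (A t) y + g\<close> on \<open>[a,b]\<close> with terminal value \<open>y(b) = c\<close>.\<close>
definition solution :: "(real \<Rightarrow> 'a) \<Rightarrow> 'a \<Rightarrow> (real \<Rightarrow> 'a) \<Rightarrow> bool" where
  "solution g c y \<longleftrightarrow> continuous_on {a..b} y \<and>
     (\<forall>r\<in>{a..b}. ((\<lambda>s. P (A s) (y s) + g s) has_integral (c - y r)) {r..b})"

lemma coefficient_bound:
  obtains K where "K > 0" "\<And>s v. s \<in> {a..b} \<Longrightarrow> norm (P (A s) v) \<le> K * norm v"
proof -
  obtain K0 where K0: "K0 > 0" "\<And>x y. norm (P x y) \<le> norm x * norm y * K0"
    using bounded_bilinear.pos_bounded[OF bounded_bilinear] by blast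
  have "bounded (A ` {a..b})"
    by (intro compact_imp_bounded compact_continuous_image continuous_A compact_Icc)
  then obtain B where B: "B > 0" "\<And>s. s \<in> {a..b} \<Longrightarrow> norm (A s) \<le> B"
    unfolding bounded_pos by blast
  show ?thesis
  proof (rule that[of "B * K0"])
    show "B * K0 > 0" using B K0 by simp
    fix s v assume s: "s \<in> {a..b}"
    have "norm (P (A s) v) \<le> norm (A s) * norm v * K0" by (rule K0(2))
    also have "\<dots> \<le> B * norm v * K0"
      using B(2)[OF s] K0(1) by (intro mult_right_mono) auto
    finally show "norm (P (A s) v) \<le> B * K0 * norm v" by (simp add: algebra_simps)
  qed
qed

lemma continuous_on_apply_A:
  "continuous_on {a..b} y \<Longrightarrow> continuous_on {a..b} (\<lambda>s. P (A s) (y s))"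
  by (rule bounded_bilinear.continuous_on[OF bounded_bilinear continuous_A])

lemma integrable_on_apply_A:
  assumes "continuous_on {a..b} y" "r \<in> {a..b}"
  shows "(\<lambda>s. P (A s) (y s)) integrable_on {r..b}"
  using assms
  by (intro integrable_continuous_interval continuous_on_subset[OF continuous_on_apply_A]) auto

lemma iterated_integral_bound:
  assumes K: "\<And>s v. s \<in> {a..b} \<Longrightarrow> norm (P (A s) v) \<le> K * norm v" "K > 0"
    and u: "\<And>k. continuous_on {a..b} (u k)"
    and u0: "\<And>r. r \<in> {a..b} \<Longrightarrow> norm (u 0 r) \<le> M"
    and u_Suc: "\<And>k r. r \<in> {a..b} \<Longrightarrow>
      norm (u (Suc k) r) \<le> norm (integral {r..b} (\<lambda>s. P (A s) (u k s)))"
    and r: "r \<in> {a..b}"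
  shows "norm (u k r) \<le> M * (K * (b - r)) ^ k / fact k"
  using r
proof (induction k arbitrary: r)
  case 0
  then show ?case using u0 by simp
next
  case (Suc k)
  have power: "((\<lambda>s. K * (M * (K * (b - s)) ^ k / fact k)) has_integral
      M * (K * (b - r)) ^ Suc k / fact (Suc k)) {r..b}"
    using Suc.prems by (intro has_integral_power_factorial) auto
  have "norm (integral {r..b} (\<lambda>s. P (A s) (u k s)))
      \<le> integral {r..b} (\<lambda>s. K * (M * (K * (b - s)) ^ k / fact k))"
  proof (rule integral_norm_bound_integral)
    show "(\<lambda>s. P (A s) (u k s)) integrable_on {r..b}"
      using Suc.prems by (intro integrable_on_apply_A u)
    show "(\<lambda>s. K * (M * (K * (b - s)) ^ k / fact k)) integrable_on {r..b}"
      using power by blast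
    fix s assume s: "s \<in> {r..b}"
    then have "s \<in> {a..b}" using Suc.prems by auto
    then have "norm (P (A s) (u k s)) \<le> K * norm (u k s)" by (rule K(1))
    also have "\<dots> \<le> K * (M * (K * (b - s)) ^ k / fact k)"
      using Suc.IH[OF \<open>s \<in> {a..b}\<close>] K(2) by (intro mult_left_mono) auto
    finally show "norm (P (A s) (u k s)) \<le> K * (M * (K * (b - s)) ^ k / fact k)" .
  qed
  also have "\<dots> = M * (K * (b - r)) ^ Suc k / fact (Suc k)"
    using power by (rule integral_unique)
  finally show ?case using u_Suc[of r k] Suc.prems by linarith
qed

primrec picard :: "(real \<Rightarrow> 'a) \<Rightarrow> 'a \<Rightarrow> nat \<Rightarrow> real \<Rightarrow> 'a" where
  "picard g c 0 = (\<lambda>r. c)"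
| "picard g c (Suc k) = (\<lambda>r. c - integral {r..b} (\<lambda>s. P (A s) (picard g c k s) + g s))"

lemma continuous_on_picard:
  assumes g: "g integrable_on {a..b}"
  shows "continuous_on {a..b} (picard g c k)"
proof (induction k)
  case 0
  show ?case by simp
next
  case (Suc k)
  have "(\<lambda>s. P (A s) (picard g c k s) + g s) integrable_on {a..b}"
    by (intro integrable_add g integrable_continuous_interval continuous_on_apply_A Suc)
  then show ?case
    by (simp only: picard.simps(2),
        intro continuous_on_diff continuous_on_const indefinite_integral_continuous_1')
qed

lemma picard_Suc_diff:
  assumes g: "g integrable_on {a..b}" and r: "r \<in> {a..b}"
  shows "picard g c (Suc (Suc k)) r - picard g c (Suc k) r
    = - integral {r..b} (\<lambda>s. P (A s) (picard g c (Suc k) s - picard g c k s))"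
proof -
  have sub: "{r..b} \<subseteq> {a..b}" using r by auto
  have int: "(\<lambda>s. P (A s) (picard g c j s) + g s) integrable_on {r..b}" for j
    using r by (intro integrable_add integrable_on_subinterval[OF g sub] integrable_on_apply_A
        continuous_on_picard[OF g])
  show ?thesis
    using integral_diff[OF int int, of "Suc k" k]
    by (simp add: bounded_bilinear.diff_right[OF bounded_bilinear])
qed

lemma uniform_limit_picard:
  assumes g: "g integrable_on {a..b}"
  obtains y where "uniform_limit {a..b} (picard g c) y sequentially"
proof -
  obtain K where K: "K > 0" "\<And>s v. s \<in> {a..b} \<Longrightarrow> norm (P (A s) v) \<le> K * norm v"
    using coefficient_bound by blast
  define d where "d k r = picard g c (Suc k) r - picard g c k r" for k r
  have d: "continuous_on {a..b} (d k)" for k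
    unfolding d_def by (intro continuous_on_diff continuous_on_picard g)
  have d_Suc: "d (Suc k) r = - integral {r..b} (\<lambda>s. P (A s) (d k s))" if "r \<in> {a..b}" for k r
    unfolding d_def using g that by (rule picard_Suc_diff)
  have "bounded (d 0 ` {a..b})"
    by (intro compact_imp_bounded compact_continuous_image d compact_Icc)
  then obtain M where M: "\<And>r. r \<in> {a..b} \<Longrightarrow> norm (d 0 r) \<le> M"
    unfolding bounded_iff by blast
  have "0 \<le> norm (d 0 a)" by simp
  also have "\<dots> \<le> M" using M a_le_b by simp
  finally have "M \<ge> 0" .
  have "norm (d k r) \<le> M * (K * (b - a)) ^ k / fact k" if r: "r \<in> {a..b}" for k r
  proof -
    have "norm (d k r) \<le> M * (K * (b - r)) ^ k / fact k"
      using K d M r d_Suc by (intro iterated_integral_bound[where u = d]) auto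
    also have "\<dots> \<le> M * (K * (b - a)) ^ k / fact k"
      using r K(1) \<open>M \<ge> 0\<close> by (intro divide_right_mono mult_left_mono power_mono) auto
    finally show ?thesis .
  qed
  then have "uniform_limit {a..b} (\<lambda>n r. \<Sum>k<n. d k r) (\<lambda>r. \<Sum>k. d k r) sequentially"
    using summable_exp_terms by (rule Weierstrass_m_test)
  then have "uniform_limit {a..b} (\<lambda>n r. c + (\<Sum>k<n. d k r)) (\<lambda>r. c + (\<Sum>k. d k r)) sequentially"
    by (intro uniform_limit_intros)
  moreover have "(\<lambda>n r. c + (\<Sum>k<n. d k r)) = picard g c"
    using sum_lessThan_telescope[of "\<lambda>k. picard g c k r" for r]
    by (intro ext) (simp add: d_def del: picard.simps(2))
  ultimately show ?thesis by (intro that) simp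
qed

lemma uniform_limit_picard_solution:
  assumes g: "g integrable_on {a..b}" and lim: "uniform_limit {a..b} (picard g c) y sequentially"
  shows "solution g c y"
proof -
  have y: "continuous_on {a..b} y"
    by (rule uniform_limit_theorem[OF _ lim]) (auto simp: continuous_on_picard[OF g])
  have "((\<lambda>s. P (A s) (y s) + g s) has_integral (c - y r)) {r..b}" if r: "r \<in> {a..b}" for r
  proof -
    have sub: "{r..b} \<subseteq> {a..b}" using r by auto
    have "bounded (y ` {r..b})" "bounded (A ` {r..b})"
      using y continuous_A sub
      by (auto intro!: compact_imp_bounded compact_continuous_image intro: continuous_on_subset)
    then have "uniform_limit {r..b} (\<lambda>n s. P (A s) (picard g c n s)) (\<lambda>s. P (A s) (y s))
        sequentially"
      by (intro bounded_bilinear.bounded_uniform_limit[OF bounded_bilinear] uniform_limit_const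
          uniform_limit_on_subset[OF lim sub])
    then obtain I J where
      I: "\<And>n. ((\<lambda>s. P (A s) (picard g c n s)) has_integral I n) {r..b}" and
      J: "((\<lambda>s. P (A s) (y s)) has_integral J) {r..b}" and IJ: "I \<longlonglongrightarrow> J"
      by (rule uniform_limit_integral)
        (auto intro: continuous_on_subset[OF continuous_on_apply_A[OF continuous_on_picard[OF g]]
          sub])
    obtain G where G: "(g has_integral G) {r..b}"
      using integrable_on_subinterval[OF g sub] by blast
    have "picard g c (Suc n) r = c - (I n + G)" for n
      using integral_unique[OF has_integral_add[OF I G]] by simp
    then have "(\<lambda>n. picard g c (Suc n) r) \<longlonglongrightarrow> c - (J + G)"
      by (simp only:) (intro tendsto_intros IJ)
    moreover have "(\<lambda>n. picard g c (Suc n) r) \<longlonglongrightarrow> y r"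
      using tendsto_uniform_limitI[OF lim r] by (rule LIMSEQ_Suc)
    ultimately have "c - y r = J + G"
      using LIMSEQ_unique by fastforce
    then show ?thesis using has_integral_add[OF J G] by simp
  qed
  with y show ?thesis unfolding solution_def by blast
qed

lemma solution_exists: "g integrable_on {a..b} \<Longrightarrow> \<exists>y. solution g c y"
  by (metis uniform_limit_picard uniform_limit_picard_solution)

lemma solution_unique:
  assumes y1: "solution g c y1" and y2: "solution g c y2" and r: "r \<in> {a..b}"
  shows "y1 r = y2 r"
proof -
  obtain K where K: "K > 0" "\<And>s v. s \<in> {a..b} \<Longrightarrow> norm (P (A s) v) \<le> K * norm v"
    using coefficient_bound by blast
  define z where "z s = y1 s - y2 s" for s
  have z: "continuous_on {a..b} z"
    using y1 y2 unfolding solution_def z_def by (intro continuous_on_diff) auto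
  have z_eq: "norm (z t) = norm (integral {t..b} (\<lambda>s. P (A s) (z s)))" if t: "t \<in> {a..b}" for t
  proof -
    have "((\<lambda>s. (P (A s) (y1 s) + g s) - (P (A s) (y2 s) + g s)) has_integral
        (c - y1 t) - (c - y2 t)) {t..b}"
      using y1 y2 t unfolding solution_def by (intro has_integral_diff) auto
    then have "((\<lambda>s. P (A s) (z s)) has_integral - z t) {t..b}"
      by (simp add: z_def bounded_bilinear.diff_right[OF bounded_bilinear])
    then show ?thesis by (simp add: integral_unique)
  qed
  have "bounded (z ` {a..b})"
    by (intro compact_imp_bounded compact_continuous_image z compact_Icc)
  then obtain M where M: "\<And>t. t \<in> {a..b} \<Longrightarrow> norm (z t) \<le> M"
    unfolding bounded_iff by blast
  have "norm (z r) \<le> M * (K * (b - r)) ^ k / fact k" for k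
    using K z M r z_eq by (intro iterated_integral_bound[where u = "\<lambda>_. z"]) auto
  moreover have "(\<lambda>k. M * (K * (b - r)) ^ k / fact k) \<longlonglongrightarrow> 0"
    by (rule summable_LIMSEQ_zero[OF summable_exp_terms])
  ultimately have "norm (z r) \<le> 0"
    by (intro LIMSEQ_le_const) auto
  then show ?thesis by (simp add: z_def)
qed

lemma solution_at_end:
  assumes "solution g c y"
  shows "y b = c"
proof -
  have "((\<lambda>s. P (A s) (y s) + g s) has_integral (c - y b)) {b..b}"
    using assms a_le_b unfolding solution_def by (metis atLeastAtMost_iff order_refl)
  then have "((\<lambda>s. P (A s) (y s) + g s) has_integral (c - y b)) {b}" by simp
  then have "c - y b = 0" using has_integral_refl(2) has_integral_unique by blast
  then show ?thesis by simp
qed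

lemma solution_has_vector_derivative:
  assumes y: "solution g c y" and g: "continuous_on {a..b} g" and r: "r \<in> {a..b}"
  shows "(y has_vector_derivative P (A r) (y r) + g r) (at r within {a..b})"
proof -
  let ?h = "\<lambda>s. P (A s) (y s) + g s"
  have h: "continuous_on {a..b} ?h"
    using y g unfolding solution_def by (intro continuous_on_add continuous_on_apply_A) auto
  have y_eq: "y t = (c - integral {a..b} ?h) + integral {a..t} ?h" if t: "t \<in> {a..b}" for t
  proof -
    have "integral {t..b} ?h = c - y t"
      using y t unfolding solution_def by (auto intro: integral_unique)
    moreover have "integral {a..b} ?h = integral {a..t} ?h + integral {t..b} ?h"
      using t by (intro Henstock_Kurzweil_Integration.integral_combine[symmetric]
          integrable_continuous_interval h) auto
    ultimately show ?thesis by (simp add: algebra_simps)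
  qed
  have "((\<lambda>t. (c - integral {a..b} ?h) + integral {a..t} ?h) has_vector_derivative ?h r)
      (at r within {a..b})"
    using has_vector_derivative_add[OF has_vector_derivative_const
        integral_has_vector_derivative[OF h r]]
    by simp
  then show ?thesis
    by (rule has_vector_derivative_transform[OF r y_eq, rotated])
qed

end

lemma bounded_bilinear_matrix_matrix_mult:
  "bounded_bilinear ((**) :: real^'n^'m \<Rightarrow> real^'k^'n \<Rightarrow> real^'k^'m)"
  unfolding bilinear_conv_bounded_bilinear[symmetric] bilinear_def
  by (auto intro!: linearI simp: matrix_matrix_mult_def vec_eq_iff sum.distrib
      sum_distrib_left algebra_simps scaleR_sum_right)

lemma bounded_bilinear_matrix_vector_mult:
  "bounded_bilinear ((*v) :: real^'m^'n \<Rightarrow> real^'m \<Rightarrow> real^'n)"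
  unfolding bilinear_conv_bounded_bilinear[symmetric] bilinear_def
  by (auto intro!: linearI simp: matrix_vector_mult_def vec_eq_iff sum.distrib
      sum_distrib_left algebra_simps scaleR_sum_right)

lemma adjoint_product_constant:
  fixes A W :: "real \<Rightarrow> real^'n^'n" and X :: "real \<Rightarrow> real^'k^'n"
  assumes W: "\<And>r. r \<in> {a..b} \<Longrightarrow> (W has_vector_derivative - (W r ** A r)) (at r within {a..b})"
    and X: "\<And>r. r \<in> {a..b} \<Longrightarrow> (X has_vector_derivative A r ** X r) (at r within {a..b})"
    and r: "r \<in> {a..b}" and s: "s \<in> {a..b}"
  shows "W r ** X r = W s ** X s"
proof -
  have "((\<lambda>t. W t ** X t) has_vector_derivative 0) (at t within {a..b})" if t: "t \<in> {a..b}" for t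
    using bounded_bilinear.has_vector_derivative[OF bounded_bilinear_matrix_matrix_mult
        W[OF t] X[OF t]]
    by (simp add: bounded_bilinear.minus_left[OF bounded_bilinear_matrix_matrix_mult]
        matrix_mul_assoc)
  then obtain C where "\<And>t. t \<in> {a..b} \<Longrightarrow> W t ** X t = C"
    using has_vector_derivative_zero_constant[OF convex_real_interval(5)] by blast
  then show ?thesis using r s by metis
qed

text \<open>Since \<open>W X\<close> is constant along every solution of \<open>X' = A X\<close>, any such \<open>X\<close> with
  \<open>X(t) = I\<close> has \<open>X(T) = W(t)\<close>; \<open>Y\<close> provides one, namely \<open>X(r) = Y(r) W(t)\<close>.\<close>
lemma state_trans_eq_adjoint_solution:
  fixes A W Y :: "real \<Rightarrow> real^'n^'n"
  assumes W: "\<And>r. r \<in> {0..T} \<Longrightarrow> (W has_vector_derivative - (W r ** A r)) (at r within {0..T})"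
      "W T = mat 1"
    and Y: "\<And>r. r \<in> {0..T} \<Longrightarrow> (Y has_vector_derivative A r ** Y r) (at r within {0..T})"
      "Y T = mat 1"
    and t: "t \<in> {0..T}"
  shows "state_trans T A T t = W t"
  unfolding state_trans_def
proof (rule the_equality)
  have T: "T \<in> {0..T}" using t by auto
  have "W t ** Y t = mat 1"
    using adjoint_product_constant[OF W(1) Y(1) t T] W(2) Y(2) by simp
  then have inverse: "Y t ** W t = mat 1"
    using matrix_left_right_inverse by blast
  have "((\<lambda>r. Y r ** W t) has_vector_derivative A r ** (Y r ** W t)) (at r within {0..T})"
    if "r \<in> {0..T}" for r
    using bounded_bilinear.has_vector_derivative[OF bounded_bilinear_matrix_matrix_mult
        Y(1)[OF that] has_vector_derivative_const[of "W t"]]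
    by (simp add: matrix_mul_assoc)
  with inverse Y(2) show "\<exists>X. X t = mat 1 \<and>
      (\<forall>r\<in>{0..T}. (X has_vector_derivative A r ** X r) (at r within {0..T})) \<and> X T = W t"
    by (intro exI[of _ "\<lambda>r. Y r ** W t"]) auto
next
  fix M
  assume "\<exists>X. X t = mat 1 \<and>
      (\<forall>r\<in>{0..T}. (X has_vector_derivative A r ** X r) (at r within {0..T})) \<and> X T = M"
  then obtain X where X: "X t = mat 1" "X T = M"
    and X': "\<And>r. r \<in> {0..T} \<Longrightarrow> (X has_vector_derivative A r ** X r) (at r within {0..T})"
    by blast
  have "W T ** X T = W t ** X t"
    using t by (intro adjoint_product_constant[OF W(1) X']) auto
  then show "M = W t" using X W(2) by simp
qed

lemma continuous_on_state_trans:
  fixes A :: "real \<Rightarrow> real^'n^'n"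
  assumes T: "T \<ge> 0" and A: "continuous_on {0..T} A"
  shows "continuous_on {0..T} (state_trans T A T)"
proof -
  interpret fundamental: linear_terminal_problem
    "(**) :: real^'n^'n \<Rightarrow> real^'n^'n \<Rightarrow> real^'n^'n" A 0 T
    using bounded_bilinear_matrix_matrix_mult A T by (rule linear_terminal_problem.intro)
  have "bounded_bilinear (\<lambda>a w :: real^'n^'n. - (w ** a))"
    using bounded_bilinear.comp[OF bounded_bilinear.flip[OF bounded_bilinear_matrix_matrix_mult]
        bounded_linear_ident bounded_linear_minus[OF bounded_linear_ident]]
    by (simp add: bounded_bilinear.minus_left[OF bounded_bilinear_matrix_matrix_mult])
  then interpret adjoint: linear_terminal_problem "\<lambda>a w :: real^'n^'n. - (w ** a)" A 0 T
    using A T by (rule linear_terminal_problem.intro)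
  obtain Y where Y: "fundamental.solution (\<lambda>_. 0) (mat 1) Y"
    using fundamental.solution_exists by blast
  obtain W where W: "adjoint.solution (\<lambda>_. 0) (mat 1) W"
    using adjoint.solution_exists by blast
  have "state_trans T A T t = W t" if "t \<in> {0..T}" for t
    using fundamental.solution_has_vector_derivative[OF Y continuous_on_const]
      adjoint.solution_has_vector_derivative[OF W continuous_on_const]
      fundamental.solution_at_end[OF Y] adjoint.solution_at_end[OF W] that
    by (intro state_trans_eq_adjoint_solution[where Y = Y]) auto
  moreover have "continuous_on {0..T} W"
    using W unfolding adjoint.solution_def by blast
  ultimately show ?thesis
    using continuous_on_cong by blast
qed

lemma continuous_on_term_sol:
  fixes A :: "real \<Rightarrow> real^'n^'n"
  assumes T: "T \<ge> 0" and A: "continuous_on {0..T} A" and w: "w integrable_on {0..T}"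
  shows "continuous_on {0..T} (term_sol T A w xbar)"
proof -
  interpret linear_terminal_problem "(*v) :: real^'n^'n \<Rightarrow> real^'n \<Rightarrow> real^'n" A 0 T
    using bounded_bilinear_matrix_vector_mult A T by (rule linear_terminal_problem.intro)
  obtain \<xi> where \<xi>: "solution w xbar \<xi>"
    using solution_exists[OF w] by blast
  have "term_sol T A w xbar t = \<xi> t" if t: "t \<in> {0..T}" for t
    unfolding term_sol_def
  proof (rule the_equality)
    show "\<exists>\<zeta>. continuous_on {0..T} \<zeta> \<and>
        (\<forall>r\<in>{0..T}. ((\<lambda>s. A s *v \<zeta> s + w s) has_integral xbar - \<zeta> r) {r..T}) \<and> \<zeta> t = \<xi> t"
      using \<xi> unfolding solution_def by blast
  next
    fix y
    assume "\<exists>\<zeta>. continuous_on {0..T} \<zeta> \<and>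
        (\<forall>r\<in>{0..T}. ((\<lambda>s. A s *v \<zeta> s + w s) has_integral xbar - \<zeta> r) {r..T}) \<and> \<zeta> t = y"
    then obtain \<zeta> where "solution w xbar \<zeta>" "\<zeta> t = y"
      unfolding solution_def by blast
    then show "y = \<xi> t" using solution_unique[OF _ \<xi> t] by blast
  qed
  moreover have "continuous_on {0..T} \<xi>"
    using \<xi> unfolding solution_def by blast
  ultimately show ?thesis
    using continuous_on_cong by blast
qed

lemma convex_hull_image_close:
  fixes p q :: "'i \<Rightarrow> 'a::real_normed_vector"
  assumes "finite I" and y: "y \<in> convex hull (q ` I)"
  shows "\<exists>x \<in> convex hull (p ` I). norm (x - y) \<le> (\<Sum>i\<in>I. norm (p i - q i))"
proof -
  let ?G = "(\<lambda>i. (p i, q i)) ` I"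
  let ?d = "\<Sum>i\<in>I. norm (p i - q i)"
  have "convex hull (p ` I) = fst ` (convex hull ?G)" "convex hull (q ` I) = snd ` (convex hull ?G)"
    by (simp_all add: convex_hull_linear_image linear_fst linear_snd image_image)
  with y obtain w where w: "w \<in> convex hull ?G" "snd w = y" and x: "fst w \<in> convex hull (p ` I)"
    by auto
  have "?G \<subseteq> (\<lambda>w. fst w - snd w) -` cball 0 ?d"
    using assms(1) by (auto intro!: member_le_sum)
  moreover have "convex ((\<lambda>w::'a \<times> 'a. fst w - snd w) -` cball 0 ?d)"
    by (intro convex_linear_vimage convex_cball linear_compose_sub linear_fst linear_snd)
  ultimately have "convex hull ?G \<subseteq> (\<lambda>w. fst w - snd w) -` cball 0 ?d"
    by (rule hull_minimal)
  then show ?thesis using w x by force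
qed

lemma infdist_convex_hull_image_le:
  fixes p q :: "'i \<Rightarrow> 'a::real_normed_vector"
  assumes "finite I" "I \<noteq> {}"
  shows "infdist y (convex hull (p ` I))
    \<le> infdist y (convex hull (q ` I)) + (\<Sum>i\<in>I. norm (p i - q i))"
proof -
  let ?d = "\<Sum>i\<in>I. norm (p i - q i)"
  have ne: "convex hull (q ` I) \<noteq> {}" using assms(2) by simp
  have "infdist y (convex hull (p ` I)) - ?d \<le> (INF z\<in>convex hull (q ` I). dist y z)"
  proof (rule cINF_greatest[OF ne])
    fix z assume "z \<in> convex hull (q ` I)"
    then obtain x where x: "x \<in> convex hull (p ` I)" "norm (x - z) \<le> ?d"
      using convex_hull_image_close[OF assms(1)] by blast
    have "infdist y (convex hull (p ` I)) \<le> dist y x" by (rule infdist_le[OF x(1)])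
    also have "\<dots> \<le> dist y z + dist x z" by (rule dist_triangle2)
    also have "\<dots> \<le> dist y z + ?d" using x(2) by (simp add: dist_norm)
    finally show "infdist y (convex hull (p ` I)) - ?d \<le> dist y z" by simp
  qed
  then show ?thesis using infdist_notempty[OF ne] by simp
qed

lemma infdist_convex_hull_image_abs_diff_le:
  fixes p q :: "'i \<Rightarrow> 'a::real_normed_vector"
  assumes "finite I" "I \<noteq> {}"
  shows "\<bar>infdist x (convex hull (p ` I)) - infdist y (convex hull (q ` I))\<bar>
     \<le> dist x y + (\<Sum>i\<in>I. norm (p i - q i))"
proof -
  have "\<bar>infdist x (convex hull (p ` I)) - infdist x (convex hull (q ` I))\<bar>
      \<le> (\<Sum>i\<in>I. norm (p i - q i))"
    using infdist_convex_hull_image_le[OF assms, of x p q]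
      infdist_convex_hull_image_le[OF assms, of x q p]
    by (simp add: norm_minus_commute)
  moreover have "\<bar>infdist x (convex hull (q ` I)) - infdist y (convex hull (q ` I))\<bar> \<le> dist x y"
    by (rule infdist_triangle_abs)
  ultimately show ?thesis by linarith
qed

lemma continuous_on_infdist_convex_hull_image:
  fixes y :: "'c::topological_space \<Rightarrow> 'a::real_normed_vector" and p :: "'c \<Rightarrow> 'i \<Rightarrow> 'a"
  assumes I: "finite I" and y: "continuous_on S y"
    and p: "\<And>i. i \<in> I \<Longrightarrow> continuous_on S (\<lambda>z. p z i)"
  shows "continuous_on S (\<lambda>z. infdist (y z) (convex hull (p z ` I)))"
proof (cases "I = {}")
  case True
  then show ?thesis by (simp add: infdist_def)
next
  case False
  show ?thesis unfolding continuous_on_def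
  proof
    fix z assume z: "z \<in> S"
    define R where "R z' = dist (y z') (y z) + (\<Sum>i\<in>I. norm (p z' i - p z i))" for z'
    have "continuous_on S R"
      unfolding R_def by (intro continuous_intros y p)
    then have "(R \<longlongrightarrow> R z) (at z within S)"
      using z unfolding continuous_on_def by blast
    moreover have "R z = 0" by (simp add: R_def)
    ultimately have "(R \<longlongrightarrow> 0) (at z within S)" by simp
    moreover have "\<forall>\<^sub>F z' in at z within S.
        norm (infdist (y z') (convex hull (p z' ` I)) - infdist (y z) (convex hull (p z ` I)))
          \<le> R z'"
      unfolding R_def real_norm_def
      by (intro always_eventually allI infdist_convex_hull_image_abs_diff_le[OF I False])
    ultimately show "((\<lambda>z. infdist (y z) (convex hull (p z ` I))) \<longlongrightarrow>
        infdist (y z) (convex hull (p z ` I))) (at z within S)"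
      by (subst LIM_zero_iff[symmetric]) (rule Lim_null_comparison)
  qed
qed

lemma mink_diff_subset_translate: "z \<in> Z \<Longrightarrow> mink_diff Y Z \<subseteq> (\<lambda>y. y - z) ` Y"
  unfolding mink_diff_def by force

lemma admissible_integrable_on:
  fixes B :: "real \<Rightarrow> real^'m^'n" and E :: "real \<Rightarrow> real^'l^'n"
  assumes B: "continuous_on {0..T} B" and E: "continuous_on {0..T} E"
    and U: "compact U" and D: "D \<noteq> {}"
    and w: "w \<in> admissible T (\<lambda>t. mink_diff (mat_image (B t) U) (mat_image (- E t) D))"
  shows "w integrable_on {0..T}"
proof -
  obtain d where d: "d \<in> D" using D by blast
  define f where "f z = B (fst z) *v snd z + E (fst z) *v d" for z
  have "continuous_on ({0..T} \<times> U) (\<lambda>z. B (fst z))" "continuous_on ({0..T} \<times> U) (\<lambda>z. E (fst z))"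
    by (auto intro!: continuous_on_compose2[OF B] continuous_on_compose2[OF E] continuous_on_fst
        continuous_on_id)
  then have "continuous_on ({0..T} \<times> U) f"
    unfolding f_def
    by (intro continuous_on_add
        bounded_bilinear.continuous_on[OF bounded_bilinear_matrix_vector_mult]
        continuous_on_snd continuous_on_id continuous_on_const)
  then have "bounded (f ` ({0..T} \<times> U))"
    by (intro compact_imp_bounded compact_continuous_image compact_Times compact_Icc U)
  then obtain M where M: "\<forall>v \<in> f ` ({0..T} \<times> U). norm v \<le> M"
    unfolding bounded_iff by blast
  show ?thesis
  proof (rule measurable_bounded_by_integrable_imp_integrable)
    show "w \<in> borel_measurable (lebesgue_on {0..T})"
      using w unfolding admissible_def by blast
    show "(\<lambda>_. M) integrable_on {0..T}"
      by (rule integrable_continuous_interval[OF continuous_on_const])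
    show "{0..T} \<in> sets lebesgue" by simp
    fix s assume s: "s \<in> {0..T}"
    have "w s \<in> mink_diff (mat_image (B s) U) (mat_image (- E s) D)"
      using w s unfolding admissible_def by blast
    moreover have "(- E s) *v d \<in> mat_image (- E s) D"
      using d unfolding mat_image_def by blast
    ultimately have "w s \<in> (\<lambda>v. v - (- E s) *v d) ` mat_image (B s) U"
      using mink_diff_subset_translate by blast
    then obtain u where "u \<in> U" "w s = f (s, u)"
      unfolding mat_image_def f_def
      by (auto simp: bounded_bilinear.minus_left[OF bounded_bilinear_matrix_vector_mult])
    then show "norm (w s) \<le> M" using M s by auto
  qed
qed

lemma Inf_norm_matrix_diff_convex_hull:
  fixes M :: "real^'m^'n" and q :: "'i \<Rightarrow> real^'m"
  assumes "I \<noteq> {}"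
  shows "Inf ((\<lambda>\<zeta>. norm (M *v (x - \<zeta>))) ` (convex hull (q ` I)))
    = infdist (M *v x) (convex hull ((\<lambda>i. M *v q i) ` I))"
proof -
  have "Inf ((\<lambda>\<zeta>. norm (M *v (x - \<zeta>))) ` (convex hull (q ` I)))
      = infdist (M *v x) ((*v) M ` (convex hull (q ` I)))"
    using assms
    by (simp add: infdist_notempty image_image dist_norm matrix_vector_mult_diff_distrib)
  also have "(*v) M ` (convex hull (q ` I)) = convex hull ((\<lambda>i. M *v q i) ` I)"
    by (simp add: convex_hull_linear_image[OF matrix_vector_mul_linear] image_image)
  finally show ?thesis .
qed

theorem lemma6:
  fixes T :: real
    and A :: "real \<Rightarrow> real^'n^'n"
    and B :: "real \<Rightarrow> real^'m^'n"
    and E :: "real \<Rightarrow> real^'l^'n"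
    and U :: "(real^'m) set" and D :: "(real^'l) set"
    and Lg \<gamma> :: real and nk :: nat
    and xbar :: "nat \<Rightarrow> real^'n"
    and \<omega> :: "nat \<Rightarrow> real \<Rightarrow> real^'n"
  assumes "T > 0"
    and "continuous_on {0..T} A" and "continuous_on {0..T} B" and "continuous_on {0..T} E"
    and "compact U" and "convex U" and "U \<noteq> {}"
    and "compact D" and "convex D" and "D \<noteq> {}"
    and "\<forall>t\<in>{0..T}. mink_diff (mat_image (B t) U) (mat_image (- E t) D) \<noteq> {}"
    and "Lg \<ge> 0"
    and "\<forall>i\<in>{1..nk}. \<omega> i \<in> admissible T (\<lambda>t. mink_diff (mat_image (B t) U) (mat_image (- E t) D))"
  shows "continuous_on ({0..T} \<times> UNIV)
           (\<lambda>(t, x). Lg * Inf ((\<lambda>\<xi>. norm (state_trans T A T t *v (x - \<xi>)))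
                         ` (convex hull {term_sol T A (\<omega> i) (xbar i) t | i. i \<in> {1..nk}})) + \<gamma>)"
proof (cases "nk = 0")
  case True
  then show ?thesis by simp
next
  case False
  let ?S = "{0..T} \<times> (UNIV :: (real^'n) set)"
  let ?\<Phi> = "state_trans T A T" and ?\<xi> = "\<lambda>i. term_sol T A (\<omega> i) (xbar i)"
  have T: "T \<ge> 0" using \<open>T > 0\<close> by simp
  have \<Phi>: "continuous_on ?S (\<lambda>z. ?\<Phi> (fst z))"
    by (auto intro!: continuous_on_compose2[OF continuous_on_state_trans[OF T assms(2)]]
        continuous_on_fst continuous_on_id)
  have \<xi>: "continuous_on ?S (\<lambda>z. ?\<xi> i (fst z))" if "i \<in> {1..nk}" for i
  proof -
    have "\<omega> i integrable_on {0..T}"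
      using assms(13) that by (intro admissible_integrable_on[OF assms(3,4,5,10)]) blast
    then show ?thesis
      by (auto intro!: continuous_on_compose2[OF continuous_on_term_sol[OF T assms(2)]]
          continuous_on_fst continuous_on_id)
  qed
  have "continuous_on ?S (\<lambda>z. Lg * infdist (?\<Phi> (fst z) *v snd z)
      (convex hull ((\<lambda>i. ?\<Phi> (fst z) *v ?\<xi> i (fst z)) ` {1..nk})) + \<gamma>)"
    by (intro continuous_on_add continuous_on_mult continuous_on_const
        continuous_on_infdist_convex_hull_image finite_atLeastAtMost \<Phi> \<xi>
        bounded_bilinear.continuous_on[OF bounded_bilinear_matrix_vector_mult]
        continuous_on_snd continuous_on_id)
  moreover have "{?\<xi> i t | i. i \<in> {1..nk}} = (\<lambda>i. ?\<xi> i t) ` {1..nk}" for t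
    by blast
  ultimately show ?thesis
    using False by (simp add: case_prod_beta Inf_norm_matrix_diff_convex_hull)
qed

end
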